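(* Let $n\ge 1$ and $\mathbf{a}=(a_1,\dots,a_n)\in\mathbb{Z}^n$. Then $F(m,\mathbf{a})\in\mathbb{Z}$ for all $m\in\mathbb{N}$, and the function $\mathbb{N}\to\mathbb{Z}/2\mathbb{Z}$, $m\mapsto F(m,\mathbf{a})\bmod 2$, is eventually periodic. Moreover, if $a_n$ is odd, then $F(m,\mathbf{a})\bmod 2$ is periodic as a function of $m\in\mathbb{N}$.
   Context: $\mathbb{N}=\{1,2,3,\dots\}$. For $k\in\mathbb{N}$, $\mathcal{P}(k)$ is the set of distinct prime factors of $k$. Given $\mathbf{a}=(a_1,\dots,a_n)\in\mathbb{Z}^n$, let $\theta_1,\dots,\theta_n$ be the roots (with multiplicity, in $\mathbb{C}$) of $X^n-a_1X^{n-1}+a_2X^{n-2}-\dots+(-1)^na_n$ (so $a_i$ is the $i$-th elementary symmetric function of the roots), and define $$F(m,\mathbf{a}):=\sum_{j\mid m}(-1)^j\,\frac{\sum_{i=1}^n\theta_i^j}{j}\prod_{p\in\mathcal{P}(m/j)}\Big(1-\frac1p\Big).$$ A function $h$ on $\mathbb{N}$ is periodic if there is $N\in\mathbb{N}$ with $h(x+N)=h(x)$ for all $x\in\mathbb{N}$, and eventually periodic if there are $N,M\in\mathbb{N}$ with $h(x+N)=h(x)$ for all $x\ge M$. *)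

theory Defs
  imports Complex_Main "HOL-Computational_Algebra.Computational_Algebra"
begin

text \<open>
  A tuple in \<open>\<int>\<^sup>n\<close> is a function \<open>a :: nat \<Rightarrow> int\<close> together with \<open>n\<close>; only the values
  \<open>a 1, \<dots>, a n\<close> are used.
\<close>

definition sym_poly :: "nat \<Rightarrow> (nat \<Rightarrow> int) \<Rightarrow> complex poly" where
  "sym_poly n a = monom 1 n + (\<Sum>i=1..n. monom ((-1) ^ i * of_int (a i)) (n - i))"

definition root_power_sum :: "nat \<Rightarrow> (nat \<Rightarrow> int) \<Rightarrow> nat \<Rightarrow> complex" where
  "root_power_sum n a j = (\<Sum>\<theta>\<in>#proots (sym_poly n a). \<theta> ^ j)"

text \<open>Only the values at \<open>m \<ge> 1\<close> are meaningful.\<close>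

definition F :: "nat \<Rightarrow> (nat \<Rightarrow> int) \<Rightarrow> nat \<Rightarrow> complex" where
  "F n a m = (\<Sum>j | j dvd m. (-1) ^ j * (root_power_sum n a j / of_nat j)
                * (\<Prod>p\<in>prime_factors (m div j). 1 - 1 / of_nat p))"

text \<open>
  The residue class modulo 2 of the integer \<open>F n a m\<close>, represented by 0 or 1. It is meaningful
  only where \<open>F n a m \<in> \<int>\<close>.
\<close>

definition F_mod2 :: "nat \<Rightarrow> (nat \<Rightarrow> int) \<Rightarrow> nat \<Rightarrow> int" where
  "F_mod2 n a m = (THE k :: int. of_int k = F n a m) mod 2"

text \<open>
  The functions below are functions on the positive integers; their value at 0 is irrelevant.
\<close>

definition periodic :: "(nat \<Rightarrow> 'b) \<Rightarrow> bool" where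
  "periodic h \<longleftrightarrow> (\<exists>N\<ge>1. \<forall>x\<ge>1. h (x + N) = h x)"

definition eventually_periodic :: "(nat \<Rightarrow> 'b) \<Rightarrow> bool" where
  "eventually_periodic h \<longleftrightarrow> (\<exists>N\<ge>1. \<exists>M\<ge>1. \<forall>x\<ge>M. h (x + N) = h x)"

end

theory Submission
  imports Defs "HOL-Number_Theory.Totient"
begin

text \<open>
  Put \<open>f(t) = 1 + a\<^sub>1 t + \<dots> + a\<^sub>n t\<^sup>n\<close>, the product of the factors \<open>1 + \<theta> t\<close> over the roots,
  let \<open>s\<^sub>j\<close> be the \<open>j\<close>-th power sum of the numbers \<open>-\<theta>\<close>, and let \<open>S = \<Sum> s\<^sub>j t\<^sup>j\<close> over \<open>j \<ge> 1\<close>, so that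
  \<open>f S = - t f'\<close>. Since \<open>\<phi>(k) = k \<Prod> (1 - 1/p)\<close>, the number \<open>F(m)\<close> equals
  \<open>N\<^sub>m = (1/m) \<Sum> \<phi>(m/d) s\<^sub>d\<close>, the sum being over the divisors \<open>d\<close> of \<open>m\<close>.
  (For \<open>f = 1 - c t\<close> this counts the necklaces of length \<open>m\<close> in \<open>c\<close> colours.)

  These definitions make sense for every integral power series \<open>f\<close> with constant term \<open>1\<close>, and
  \<open>f \<mapsto> (S, N)\<close> turns products into sums. Writing \<open>N(t) = \<Sum> N\<^sub>m t\<^sup>m\<close>, the key fact
  (\<open>necklace_data_exists\<close>) is that all \<open>N\<^sub>m\<close> are integers and that
  \<open>f(t) f(-t) \<equiv> f(t\<^sup>2) (1 + 2 (N(t) - S(t)))\<close> modulo \<open>4\<close>.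
  Both claims are multiplicative in \<open>f\<close>, pass to inverses, and are checked by hand for
  \<open>f = 1 - t\<^sup>e\<close>, where \<open>N = t\<^sup>e / (1 - t\<^sup>e)\<close> and \<open>S = e N\<close>. Every \<open>f\<close> agrees up to any given degree
  with a product of powers of such series, and the \<open>m\<close>-th coefficients in both claims involve only
  finitely many coefficients of \<open>f\<close>.

  Working modulo \<open>4\<close> is what makes the parity of \<open>N\<^sub>m\<close> visible also for even \<open>m\<close>: modulo \<open>2\<close>, the
  relation \<open>f S = - t f'\<close> alone only sees the combinations \<open>m N\<^sub>m\<close>. For a polynomial
  \<open>f\<close> of degree at most \<open>n\<close> the congruence says that \<open>f(t\<^sup>2) N\<close> is congruent modulo \<open>2\<close> to a polynomial of degree at most \<open>2n\<close>
  (\<open>necklace_data_even_recurrence\<close>). Hence \<open>N\<^sub>m\<close> modulo \<open>2\<close> obeys a linear recurrence of order \<open>2n\<close>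
  from \<open>m = 1\<close> on and is eventually periodic. The last coefficient of the recurrence
  is \<open>a\<^sub>n\<close>; if it is odd, the recurrence can be run backwards and the sequence is periodic from \<open>m = 1\<close>.
\<close>

section \<open>Power series coefficient by coefficient\<close>

lemma numeral_dvd_fps_iff:
  fixes f :: "int fps"
  shows "numeral k dvd f \<longleftrightarrow> (\<forall>m. numeral k dvd f $ m)"
proof
  assume "numeral k dvd f"
  then obtain g where "f = numeral k * g" by (elim dvdE)
  then show "\<forall>m. numeral k dvd f $ m" by (simp add: numeral_fps_const)
next
  assume *: "\<forall>m. numeral k dvd f $ m"
  have "f = numeral k * Abs_fps (\<lambda>m. f $ m div numeral k)"
    using * by (intro fps_ext) (simp add: numeral_fps_const)
  then show "numeral k dvd f" by (rule dvdI)
qed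

lemma fps_mult_nth_cong:
  assumes "\<And>i. i \<le> m \<Longrightarrow> f $ i = f' $ i" "\<And>i. i \<le> m \<Longrightarrow> g $ i = g' $ i"
  shows "(f * g) $ m = (f' * g') $ m"
  using assms by (simp add: fps_mult_nth)

text \<open>
  Division by \<open>f\<close> is causal: the coefficients of \<open>f A\<close> up to degree \<open>m\<close> determine those of \<open>A\<close>. This is
  what allows \<open>f\<close> to be replaced by an approximation when only one coefficient is at stake.
\<close>
lemma fps_solution_unique_upto:
  fixes f :: "'a :: comm_ring_1 fps"
  assumes "f $ 0 = 1" "\<And>i. i \<le> m \<Longrightarrow> (f * A) $ i = (f * B) $ i" "j \<le> m"
  shows "A $ j = B $ j"
  using \<open>j \<le> m\<close>
proof (induction j rule: less_induct)
  case (less j)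
  have split: "(f * C) $ j = C $ j + (\<Sum>i=1..j. f $ i * C $ (j - i))" for C
    by (simp add: fps_mult_nth sum.atLeast_Suc_atMost assms(1))
  have "(\<Sum>i=1..j. f $ i * A $ (j - i)) = (\<Sum>i=1..j. f $ i * B $ (j - i))"
    using less by (intro sum.cong) auto
  then show ?case
    using assms(2)[of j] less.prems by (simp add: split)
qed

section \<open>Necklace numbers of an integral power series\<close>

text \<open>
  A relation rather than a pair of functions of \<open>f\<close>: the integrality of the necklace numbers is then
  part of the existence of \<open>N\<close>, and the closure properties below need no division. The
  congruence compares \<open>f(t) f(-t)\<close>, which as a series in \<open>t\<^sup>2\<close> belongs to the squares of the
  roots, with \<open>f(t\<^sup>2)\<close>; the two agree modulo \<open>2\<close>, and \<open>N - S\<close> measures their quotient modulo \<open>4\<close>.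
\<close>
definition necklace_data :: "int fps \<Rightarrow> int fps \<Rightarrow> int fps \<Rightarrow> bool" where
  "necklace_data f S N \<longleftrightarrow>
     f $ 0 = 1 \<and> N $ 0 = 0 \<and>
     f * S = - (fps_X * fps_deriv f) \<and>
     (\<forall>m\<ge>1. int m * N $ m = (\<Sum>d | d dvd m. int (totient (m div d)) * S $ d)) \<and>
     4 dvd f * (f oo - fps_X) - (f oo fps_X\<^sup>2) * (1 + 2 * (N - S))"

lemma necklace_data_one: "necklace_data 1 0 0"
  by (simp add: necklace_data_def)

text \<open>
  The factors \<open>1 + 2 E\<close> and \<open>1 + 2 E'\<close> multiply to \<open>1 + 2 (E + E')\<close> modulo \<open>4\<close>, in step with the
  additivity of the logarithmic derivative.
\<close>
lemma necklace_data_mult: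
  assumes "necklace_data f S N" "necklace_data g T M"
  shows "necklace_data (f * g) (S + T) (N + M)"
proof -
  have "(f * g) * (S + T) = (f * S) * g + f * (g * T)"
    by (simp add: algebra_simps)
  also have "\<dots> = - (fps_X * fps_deriv (f * g))"
    using assms by (simp add: necklace_data_def algebra_simps)
  finally have 1: "(f * g) * (S + T) = - (fps_X * fps_deriv (f * g))" .
  have 2: "4 dvd (f * g) * (f * g oo - fps_X) -
             (f * g oo fps_X\<^sup>2) * (1 + 2 * ((N + M) - (S + T)))"
  proof -
    define A B A' B' where defs: "A = f * (f oo - fps_X)" "B = f oo fps_X\<^sup>2"
      "A' = g * (g oo - fps_X)" "B' = g oo fps_X\<^sup>2"
    define e where "e = 1 + 2 * (N - S)"
    define e' where "e' = 1 + 2 * (M - T)"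
    have d: "4 dvd A - B * e" "4 dvd A' - B' * e'"
      using assms by (simp_all add: necklace_data_def defs e_def e'_def)
    have "(f * g) * (f * g oo - fps_X) - (f * g oo fps_X\<^sup>2) * (1 + 2 * ((N + M) - (S + T)))
      = A * A' - B * B' * (1 + 2 * ((N + M) - (S + T)))"
      by (simp add: defs fps_compose_mult_distrib)
    also have "\<dots> = A' * (A - B * e) + B * e * (A' - B' * e') + 4 * (B * B' * (N - S) * (M - T))"
      by (simp add: e_def e'_def algebra_simps)
    finally show ?thesis using d by (simp add: dvd_add dvd_mult)
  qed
  show ?thesis
    using assms 1 2
    by (auto simp: necklace_data_def algebra_simps sum.distrib)
qed

text \<open>Modulo \<open>4\<close>, the inverse of \<open>1 + 2 E\<close> is \<open>1 - 2 E\<close>.\<close>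
lemma necklace_data_inverse:
  assumes "necklace_data f S N" "f * h = 1"
  shows "necklace_data h (- S) (- N)"
proof -
  have f: "f $ 0 = 1" "f * S = - (fps_X * fps_deriv f)"
    using assms(1) by (auto simp: necklace_data_def)
  have h0: "h $ 0 = 1"
    using arg_cong[OF assms(2), of "\<lambda>u. u $ 0"] f by simp
  have "fps_deriv (f * h) = 0" by (simp add: assms(2))
  then have d: "f * fps_deriv h = - (fps_deriv f * h)"
    by (simp add: eq_neg_iff_add_eq_0 algebra_simps)
  have "- (fps_X * fps_deriv h) = - fps_X * (f * fps_deriv h) * h"
    using assms(2) by (simp add: algebra_simps)
  also have "\<dots> = (fps_X * fps_deriv f) * h * h"
    by (simp add: d algebra_simps)
  also have "\<dots> = - (f * S) * h * h" by (simp add: f)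
  also have "\<dots> = (f * h) * (h * (- S))" by (simp add: algebra_simps)
  finally have 1: "h * (- S) = - (fps_X * fps_deriv h)" by (simp add: assms(2))
  define A B C D where defs: "A = f * (f oo - fps_X)" "B = f oo fps_X\<^sup>2"
    "C = h * (h oo - fps_X)" "D = h oo fps_X\<^sup>2"
  have "(f oo - fps_X) * (h oo - fps_X) = 1" "B * D = 1"
    by (simp_all add: defs assms(2) fps_compose_mult_distrib [symmetric])
  then have inv: "A * C = 1" "B * D = 1"
    using assms(2) by (simp_all add: defs) (metis mult.assoc mult.left_commute mult_1)
  have "4 dvd A - B * (1 + 2 * (N - S))"
    using assms(1) by (simp add: necklace_data_def defs)
  \<comment> \<open>The multiplier is chosen to clear \<open>A\<close>, \<open>B\<close> and \<open>1 + 2 (N - S)\<close>, so that \<open>D (1 - 2 (N - S)) - C\<close> is left modulo \<open>4\<close>.\<close>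
  then have dv: "4 dvd (A - B * (1 + 2 * (N - S))) * (C * D * (1 - 2 * (N - S)))"
    by (rule dvd_mult2)
  have "(A - B * (1 + 2 * (N - S))) * (C * D * (1 - 2 * (N - S)))
      = (A * C) * (D * (1 - 2 * (N - S))) - (B * D) * C * (1 - 4 * (N - S)\<^sup>2)"
    by (simp add: algebra_simps power2_eq_square)
  also have "\<dots> = - (C - D * (1 + 2 * (- N - - S))) + 4 * (C * (N - S)\<^sup>2)"
    by (simp add: inv algebra_simps)
  finally have "4 dvd C - D * (1 + 2 * (- N - - S))"
    using dv by (metis dvd_add_left_iff dvd_minus_iff dvd_triv_left)
  then show ?thesis
    using assms(1) h0 1
    by (auto simp: necklace_data_def defs sum_negf)
qed

text \<open>Writing \<open>m = e q\<close> and \<open>d = m / k\<close>, the condition \<open>e dvd d\<close> becomes \<open>k dvd q\<close>.\<close>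
lemma sum_totient_multiples:
  fixes m e :: nat
  assumes "m \<ge> 1" "e dvd m"
  shows "(\<Sum>d | d dvd m \<and> e dvd d. totient (m div d)) = m div e"
proof -
  obtain q where q: "m = e * q" using assms by auto
  then have pos: "e > 0" "q > 0" using assms by auto
  have "(\<Sum>d | d dvd m \<and> e dvd d. totient (m div d)) = (\<Sum>k | k dvd q. totient k)"
    using pos
    by (intro sum.reindex_bij_witness[of _ "\<lambda>k. e * (q div k)" "\<lambda>d. m div d"])
       (auto simp: q elim!: dvdE)
  then show ?thesis using pos by (simp add: totient_divisor_sum q)
qed

text \<open>
  The building blocks. Here \<open>J = x / (1 - x)\<close> for \<open>x = t\<^sup>e\<close>. The factor \<open>f(-t)\<close> is \<open>1 - x\<close>
  or \<open>1 + x\<close> according to the parity of \<open>e\<close>, and the correction \<open>1 - e\<close> in \<open>N - S = (1 - e) J\<close> is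
  odd or even in the same cases, which is why the congruence holds in both.
\<close>
lemma necklace_data_one_minus_X_power:
  assumes "e \<ge> 1"
  defines "J \<equiv> Abs_fps (\<lambda>m. if m \<noteq> 0 \<and> e dvd m then 1 else 0)"
  shows "necklace_data (1 - fps_X ^ e) (fps_const (int e) * J) J"
proof -
  let ?x = "fps_X ^ e :: int fps"
  have J: "(1 - ?x) * J = ?x"
  proof (rule fps_ext)
    fix m
    have "m < e \<Longrightarrow> m \<noteq> 0 \<Longrightarrow> \<not> e dvd m" by (auto dest: dvd_imp_le)
    then show "((1 - ?x) * J) $ m = ?x $ m"
      using assms(1) by (auto simp: left_diff_distrib fps_X_power_mult_nth J_def dvd_minus_self)
  qed
  have 1: "(1 - ?x) * (fps_const (int e) * J) = - (fps_X * fps_deriv (1 - ?x))"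
  proof -
    have "- (fps_X * fps_deriv (1 - ?x)) = fps_const (int e) * ?x"
    proof (rule fps_ext)
      fix i
      show "(- (fps_X * fps_deriv (1 - ?x))) $ i = (fps_const (int e) * ?x) $ i"
        using assms(1) by (cases i) (auto simp: fps_X_power_iff)
    qed
    then show ?thesis using J by (metis mult.left_commute)
  qed
  have 2: "int m * J $ m = (\<Sum>d | d dvd m. int (totient (m div d)) * (fps_const (int e) * J) $ d)"
    if "m \<ge> 1" for m
  proof -
    have fin: "finite {d. d dvd m}" using that by simp
    have "(\<Sum>d | d dvd m. int (totient (m div d)) * (fps_const (int e) * J) $ d)
      = (\<Sum>d | d dvd m. if e dvd d then int e * int (totient (m div d)) else 0)"
      using that by (intro sum.cong) (auto simp: J_def)
    also have "\<dots> = (\<Sum>d | d dvd m \<and> e dvd d. int e * int (totient (m div d)))"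
      using fin by (simp add: sum.inter_filter [symmetric])
    also have "\<dots> = int e * int (\<Sum>d | d dvd m \<and> e dvd d. totient (m div d))"
      by (simp add: sum_distrib_left)
    also have "\<dots> = int m * J $ m"
    proof (cases "e dvd m")
      case True
      then show ?thesis using that
        by (simp add: sum_totient_multiples J_def flip: of_nat_mult)
    next
      case False
      then have "{d. d dvd m \<and> e dvd d} = {}" by (auto intro: dvd_trans)
      then show ?thesis using False by (simp only: J_def) simp
    qed
    finally show ?thesis by simp
  qed
  have sq: "(1 - ?x) oo fps_X\<^sup>2 = (1 - ?x) * (1 + ?x)"
  proof -
    have "(1 - ?x) oo fps_X\<^sup>2 = 1 - (fps_X\<^sup>2) ^ e"
      by (simp add: fps_compose_sub_distrib fps_compose_power [symmetric])
    then show ?thesis by (simp add: algebra_simps power2_eq_square power_mult_distrib)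
  qed
  have ng: "(1 - ?x) oo - fps_X = 1 - (- fps_X) ^ e"
    by (simp add: fps_compose_sub_distrib fps_compose_power [symmetric])
  have "(1 - ?x) * (1 + ?x) * (1 + 2 * (J - fps_const (int e) * J))
    = (1 - ?x) * (1 + ?x) + 2 * (1 - fps_const (int e)) * (1 + ?x) * ((1 - ?x) * J)"
    by (simp add: algebra_simps)
  also have "\<dots> = (1 - ?x) * (1 + ?x) + 2 * (1 - fps_const (int e)) * (1 + ?x) * ?x"
    by (simp only: J)
  finally have rhs: "(1 - ?x) * (1 + ?x) * (1 + 2 * (J - fps_const (int e) * J)) = \<dots>" .
  have "4 dvd (1 - ?x) * ((1 - ?x) oo - fps_X)
          - ((1 - ?x) oo fps_X\<^sup>2) * (1 + 2 * (J - fps_const (int e) * J))"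
  proof (cases "even e")
    case True
    then obtain k where k: "e = 2 * k" by auto
    have "(1 - ?x) * ((1 - ?x) oo - fps_X)
          - ((1 - ?x) oo fps_X\<^sup>2) * (1 + 2 * (J - fps_const (int e) * J))
       = 4 * (?x * (of_nat k - 1) + ?x * ?x * of_nat k)"
    proof -
      have "(1 - z) * (1 - z) - ((1 - z) * (1 + z) + 2 * (1 - 2 * K) * (1 + z) * z)
          = 4 * (z * (K - 1) + z * z * K)" for z K :: "int fps"
        by (simp add: algebra_simps)
      moreover have "(- fps_X) ^ e = ?x" using True by (simp only: power_minus_even)
      moreover have "fps_const (int e) = 2 * of_nat k"
        by (simp add: k fps_of_nat [symmetric])
      ultimately show ?thesis unfolding sq rhs unfolding ng by (simp only:)
    qed
    then show ?thesis by simp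
  next
    case False
    then obtain k where k: "e = 2 * k + 1" by (auto elim: oddE)
    have "(1 - ?x) * ((1 - ?x) oo - fps_X)
          - ((1 - ?x) oo fps_X\<^sup>2) * (1 + 2 * (J - fps_const (int e) * J))
       = 4 * (of_nat k * (1 + ?x) * ?x)"
    proof -
      have "(1 - z) * (1 + z) - ((1 - z) * (1 + z) + 2 * (1 - (1 + 2 * K)) * (1 + z) * z)
          = 4 * (K * (1 + z) * z)" for z K :: "int fps"
        by (simp add: algebra_simps)
      moreover have "fps_const (int e) = 1 + 2 * of_nat k"
        by (simp add: k fps_of_nat [symmetric])
      moreover have "1 - (- fps_X) ^ e = 1 + ?x" using False by (simp only: power_minus_odd diff_minus_eq_add simp_thms)
      ultimately show ?thesis unfolding sq rhs unfolding ng by (simp only:)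
    qed
    then show ?thesis by simp
  qed
  then show ?thesis
    using assms(1) 1 2 by (auto simp: necklace_data_def J_def)
qed

text \<open>
  Multiplying by \<open>1 - t\<^sup>e\<close> or by its inverse changes the coefficient of \<open>t\<^sup>e\<close> by \<open>-1\<close> or \<open>+1\<close> and
  leaves the lower ones alone, because the constant term is \<open>1\<close>.
\<close>
lemma necklace_data_adjust_coeff:
  assumes "necklace_data g S N" "e \<ge> 1"
  shows "\<exists>g' S' N'. necklace_data g' S' N' \<and> (\<forall>i<e. g' $ i = g $ i) \<and> g' $ e = g $ e + c"
proof (induction c rule: int_induct[of _ 0])
  case base
  then show ?case using assms by auto
next
  case (step1 c)
  then obtain g' S' N' where g': "necklace_data g' S' N'" "\<forall>i<e. g' $ i = g $ i" "g' $ e = g $ e + c"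
    by auto
  define h where "h = fps_right_inverse (1 - fps_X ^ e :: int fps) 1"
  have h: "(1 - fps_X ^ e) * h = 1"
    unfolding h_def using assms(2) by (intro fps_right_inverse) simp
  have g'0: "g' $ 0 = 1" using g' by (simp add: necklace_data_def)
  have eq: "g' * h = g' + fps_X ^ e * (g' * h)"
  proof -
    have "g' = (1 - fps_X ^ e) * h * g'" by (simp add: h)
    then show ?thesis by (simp add: algebra_simps)
  qed
  have h0: "h $ 0 = 1" by (simp add: h_def)
  have "(g' * h) $ i = (g' + fps_X ^ e * (g' * h)) $ i" for i
    using eq by simp
  then have "(g' * h) $ i = g' $ i + (if i < e then 0 else (g' * h) $ (i - e))" for i
    by (simp add: fps_X_power_mult_nth)
  then have "\<forall>i<e. (g' * h) $ i = g $ i" "(g' * h) $ e = g $ e + (c + 1)"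
    using g' g'0 h0 by simp_all
  moreover from necklace_data_mult[OF g'(1)
      necklace_data_inverse[OF necklace_data_one_minus_X_power[OF assms(2)] h]]
  have "\<exists>S N. necklace_data (g' * h) S N" by blast
  ultimately show ?case by blast
next
  case (step2 c)
  then obtain g' S' N' where g': "necklace_data g' S' N'" "\<forall>i<e. g' $ i = g $ i" "g' $ e = g $ e + c"
    by auto
  have g'0: "g' $ 0 = 1" using g' by (simp add: necklace_data_def)
  have "(g' * (1 - fps_X ^ e)) $ i = g' $ i - (if i < e then 0 else g' $ (i - e))" for i
    by (simp add: algebra_simps fps_X_power_mult_nth fps_X_power_mult_right_nth)
  then have "\<forall>i<e. (g' * (1 - fps_X ^ e)) $ i = g $ i" "(g' * (1 - fps_X ^ e)) $ e = g $ e + (c - 1)"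
    using g' g'0 by simp_all
  moreover from necklace_data_mult[OF g'(1) necklace_data_one_minus_X_power[OF assms(2)]]
  have "\<exists>S N. necklace_data (g' * (1 - fps_X ^ e)) S N" by blast
  ultimately show ?case by blast
qed

lemma necklace_data_dense:
  fixes f :: "int fps"
  assumes "f $ 0 = 1"
  shows "\<exists>g S N. necklace_data g S N \<and> (\<forall>i\<le>K. g $ i = f $ i)"
proof (induction K)
  case 0
  then show ?case using necklace_data_one assms by (metis fps_one_nth le_zero_eq)
next
  case (Suc K)
  then obtain g S N where g: "necklace_data g S N" "\<forall>i\<le>K. g $ i = f $ i" by blast
  from necklace_data_adjust_coeff[OF g(1), of "Suc K" "f $ Suc K - g $ Suc K"]
  obtain g' S' N' where "necklace_data g' S' N'" "\<forall>i<Suc K. g' $ i = g $ i" "g' $ Suc K = f $ Suc K"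
    by auto
  then show ?case using g(2) by (metis le_Suc_eq less_Suc_eq_le)
qed

text \<open>
  \<open>S\<close> is forced by \<open>f S = - t f'\<close>, and \<open>N\<close> is defined by integer division. That the division is exact
  and that the congruence holds at degree \<open>K\<close> is read off an approximation \<open>g\<close> of \<open>f\<close> up to degree
  \<open>K\<close>, since all the quantities there depend only on the coefficients up to \<open>K\<close>.
\<close>
theorem necklace_data_exists:
  fixes f :: "int fps"
  assumes f0: "f $ 0 = 1"
  shows "\<exists>S N. necklace_data f S N"
proof -
  define S where "S = fps_right_inverse f 1 * - (fps_X * fps_deriv f)"
  have fS: "f * S = - (fps_X * fps_deriv f)"
    unfolding S_def mult.assoc [symmetric] using f0 by (subst fps_right_inverse) simp_all
  define G where "G = (\<lambda>m. \<Sum>d | d dvd m. int (totient (m div d)) * S $ d)"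
  define N where "N = Abs_fps (\<lambda>m. if m = 0 then 0 else G m div int m)"
  have approx: "(\<forall>m. 1 \<le> m \<and> m \<le> K \<longrightarrow> int m * N $ m = G m) \<and>
     4 dvd (f * (f oo - fps_X) - (f oo fps_X\<^sup>2) * (1 + 2 * (N - S))) $ K" for K
  proof -
    obtain g T M where g: "necklace_data g T M" and gf: "\<And>i. i \<le> K \<Longrightarrow> g $ i = f $ i"
      using necklace_data_dense[OF f0, of K] by blast
    have gT: "g * T = - (fps_X * fps_deriv g)"
      using g by (simp add: necklace_data_def)
    have ST: "S $ j = T $ j" if "j \<le> K" for j
    proof (rule fps_solution_unique_upto[OF f0 _ that])
      fix i assume i: "i \<le> K"
      have "(f * T) $ i = (g * T) $ i"
        using gf i by (intro fps_mult_nth_cong) auto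
      also have "\<dots> = (f * S) $ i"
        using gf i by (cases i) (simp_all add: gT fS)
      finally show "(f * S) $ i = (f * T) $ i" ..
    qed
    have GM: "int m * M $ m = G m" if "1 \<le> m" "m \<le> K" for m
    proof -
      have "int m * M $ m = (\<Sum>d | d dvd m. int (totient (m div d)) * T $ d)"
        using g that by (simp add: necklace_data_def)
      also have "\<dots> = G m"
        unfolding G_def using that ST by (intro sum.cong) (auto dest!: dvd_imp_le)
      finally show ?thesis .
    qed
    have NM: "N $ m = M $ m" if "m \<le> K" for m
    proof (cases "m = 0")
      case True
      then show ?thesis using g by (simp add: N_def necklace_data_def)
    next
      case False
      then have "G m div int m = M $ m"
        using GM[of m] that by (metis One_nat_def Suc_leI nonzero_mult_div_cancel_left not_gr_zero of_nat_eq_0_iff)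
      then show ?thesis using False by (simp add: N_def)
    qed
    have "(f * (f oo - fps_X)) $ K = (g * (g oo - fps_X)) $ K"
      using gf by (intro fps_mult_nth_cong) (auto simp: fps_compose_uminus')
    moreover have "((f oo fps_X\<^sup>2) * (1 + 2 * (N - S))) $ K = ((g oo fps_X\<^sup>2) * (1 + 2 * (M - T))) $ K"
      using gf ST NM by (intro fps_mult_nth_cong) (auto simp: fps_nth_compose_X_power numeral_fps_const)
    moreover have "4 dvd (g * (g oo - fps_X) - (g oo fps_X\<^sup>2) * (1 + 2 * (M - T))) $ K"
      using g numeral_dvd_fps_iff by (auto simp: necklace_data_def)
    ultimately show ?thesis using GM NM by simp
  qed
  have "necklace_data f S N"
    unfolding necklace_data_def numeral_dvd_fps_iff
    using f0 fS approx by (auto simp: N_def G_def)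
  then show ?thesis by blast
qed


section \<open>Periodicity of parity recurrences\<close>

text \<open>
  Two equal states exist by the pigeonhole principle. From there on everything repeats, and if the
  dynamics is injective the coincidence can be pulled back to time \<open>1\<close>.
\<close>
lemma periodic_states:
  fixes T :: "nat \<Rightarrow> 'b"
  assumes fin: "finite (T ` {1..})"
    and forward: "\<And>x y. x \<ge> 1 \<Longrightarrow> y \<ge> 1 \<Longrightarrow> T x = T y \<Longrightarrow> T (Suc x) = T (Suc y)"
  shows "eventually_periodic T"
    and "(\<And>x y. x \<ge> 1 \<Longrightarrow> y \<ge> 1 \<Longrightarrow> T (Suc x) = T (Suc y) \<Longrightarrow> T x = T y) \<Longrightarrow> periodic T"
proof -
  have "\<not> inj_on T {1..}"
    using fin infinite_Ici[of 1] finite_imageD by blast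
  then obtain u v where uv: "u \<ge> 1" "u < v" "T u = T v"
    unfolding inj_on_def by (metis atLeast_iff linorder_neqE_nat)
  have run: "T (x + k) = T (y + k)" if "x \<ge> 1" "y \<ge> 1" "T x = T y" for x y k
    using that by (induction k) (auto intro: forward)
  have shift: "T (u + k + (v - u)) = T (u + k)" for k
    using run[of u v k] uv by (simp add: add.commute add.left_commute)
  have "T (x + (v - u)) = T x" if "x \<ge> u" for x
    using shift[of "x - u"] that by simp
  then show "eventually_periodic T"
    unfolding eventually_periodic_def using uv
    by (intro exI[of _ "v - u"] conjI exI[of _ u]) auto
  assume backward: "\<And>x y. x \<ge> 1 \<Longrightarrow> y \<ge> 1 \<Longrightarrow> T (Suc x) = T (Suc y) \<Longrightarrow> T x = T y"
  have descend: "T (1 + k) = T (1 + (v - u) + k) \<Longrightarrow> T 1 = T (1 + (v - u))" for k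
  proof (induction k)
    case (Suc k)
    have "T (1 + k) = T (1 + (v - u) + k)"
      by (rule backward) (use Suc.prems in simp_all)
    then show ?case by (rule Suc.IH)
  qed simp
  have "T 1 = T (1 + (v - u))"
    using descend[of "u - 1"] uv by simp
  then have "T (x + (v - u)) = T x" if "x \<ge> 1" for x
    using run[of 1 "1 + (v - u)" "x - 1"] that by (simp add: add.commute)
  then show "periodic T"
    unfolding periodic_def using uv by (intro exI[of _ "v - u"]) auto
qed

text \<open>
  The state at time \<open>x\<close> is the window of parities of \<open>h x, \<dots>, h (x + D - 1)\<close>. As \<open>c 0\<close> is odd, the
  recurrence determines the entry that enters the window; if \<open>c D\<close> is odd, it also determines the
  entry that leaves it.
\<close>
lemma periodic_of_even_recurrence:
  fixes c h :: "nat \<Rightarrow> int"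
  assumes "D \<ge> 1" "odd (c 0)"
    and rec: "\<And>x. x \<ge> 1 \<Longrightarrow> even (\<Sum>i\<le>D. c i * h (x + D - i))"
  shows "eventually_periodic (\<lambda>m. h m mod 2)"
    and "odd (c D) \<Longrightarrow> periodic (\<lambda>m. h m mod 2)"
proof -
  define T where "T = (\<lambda>x. map (\<lambda>i. h (x + i) mod 2) [0..<D])"
  have T_eq: "T x = T y \<longleftrightarrow> (\<forall>i<D. even (h (x + i) - h (y + i)))" for x y
    by (auto simp: T_def mod_eq_dvd_iff)
  have "T ` {1..} \<subseteq> {xs. set xs \<subseteq> {0, 1} \<and> length xs = D}"
    by (auto simp: T_def)
  then have fin: "finite (T ` {1..})"
    by (rule finite_subset) (simp add: finite_lists_length_eq)
  have diff: "even (\<Sum>i\<le>D. c i * (h (x + (D - i)) - h (y + (D - i))))" if "x \<ge> 1" "y \<ge> 1" for x y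
  proof -
    have "(\<Sum>i\<le>D. c i * (h (x + (D - i)) - h (y + (D - i))))
      = (\<Sum>i\<le>D. c i * h (x + D - i)) - (\<Sum>i\<le>D. c i * h (y + D - i))"
      unfolding sum_subtractf [symmetric] by (intro sum.cong) (auto simp: algebra_simps)
    then show ?thesis using rec that by simp
  qed
  have forward: "T (Suc x) = T (Suc y)" if "x \<ge> 1" "y \<ge> 1" "T x = T y" for x y
  proof -
    have e: "even (h (x + i) - h (y + i))" if "i < D" for i
      using that \<open>T x = T y\<close> T_eq by auto
    have "even (\<Sum>i\<in>{..D} - {0}. c i * (h (x + (D - i)) - h (y + (D - i))))"
      by (intro dvd_sum dvd_mult e) auto
    with diff[OF that(1,2)] have "even (c 0 * (h (x + D) - h (y + D)))"
      by (simp add: sum.remove[of _ 0])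
    then have "even (h (x + D) - h (y + D))" using assms(2) by simp
    then have "even (h (x + Suc i) - h (y + Suc i))" if "i < D" for i
      using e[of "Suc i"] that by (cases "Suc i = D") auto
    then show ?thesis unfolding T_eq by simp
  qed
  have backward: "T x = T y" if "odd (c D)" "x \<ge> 1" "y \<ge> 1" "T (Suc x) = T (Suc y)" for x y
  proof -
    have e: "even (h (x + i) - h (y + i))" if "0 < i" "i \<le> D" for i
    proof -
      have "i - 1 < D" using that by simp
      then have "even (h (Suc x + (i - 1)) - h (Suc y + (i - 1)))"
        using \<open>T (Suc x) = T (Suc y)\<close> unfolding T_eq by blast
      then show ?thesis using that by simp
    qed
    have "even (\<Sum>i\<in>{..D} - {D}. c i * (h (x + (D - i)) - h (y + (D - i))))"
      by (intro dvd_sum dvd_mult e) auto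
    with diff[OF that(2,3)] have "even (c D * (h x - h y))"
      by (simp add: sum.remove[of _ D])
    then have "even (h x - h y)" using that(1) by simp
    then have "even (h (x + i) - h (y + i))" if "i < D" for i
      using e[of i] that by (cases "i = 0") auto
    then show ?thesis unfolding T_eq by blast
  qed
  have hd: "h x mod 2 = hd (T x)" for x
    using assms(1) by (simp add: T_def hd_map)
  have "eventually_periodic T"
    by (rule periodic_states(1)[OF fin forward])
  then show "eventually_periodic (\<lambda>m. h m mod 2)"
    unfolding hd eventually_periodic_def by metis
  assume "odd (c D)"
  have "periodic T"
    by (rule periodic_states(2)[OF fin forward backward[OF \<open>odd (c D)\<close>]])
  then show "periodic (\<lambda>m. h m mod 2)"
    unfolding hd periodic_def by metis
qed

section \<open>The recurrence for a polynomial\<close>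

text \<open>
  With \<open>A = f(t\<^sup>2)\<close> and \<open>g = f(-t)\<close>, split \<open>A N = A (N - S) + A S\<close>. The congruence
  modulo \<open>4\<close> gives \<open>2 A (N - S) \<equiv> f g - A\<close>, of degree at most \<open>2n\<close>. Modulo \<open>2\<close> it also gives
  \<open>A \<equiv> f g\<close>, so that \<open>A S \<equiv> g (f S) = - t g f'\<close>, again of degree at most \<open>2n\<close>.
\<close>
lemma necklace_data_even_recurrence:
  assumes data: "necklace_data f S N" and deg: "\<And>i. i > n \<Longrightarrow> f $ i = 0" and m: "m > 2 * n"
  shows "even (((f oo fps_X\<^sup>2) * N) $ m)"
proof -
  define g A where "g = f oo - fps_X" and "A = f oo fps_X\<^sup>2"
  have deg_g: "g $ i = 0" if "i > n" for i
    using deg that by (simp add: g_def fps_compose_uminus')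
  have deg_A: "A $ i = 0" if "i > 2 * n" for i
    using deg[of "i div 2"] that by (auto simp: A_def fps_nth_compose_X_power elim!: evenE)
  have prod0: "(u * v) $ m = 0" if "\<And>i. i > n \<Longrightarrow> u $ i = 0" "\<And>i. i > n \<Longrightarrow> v $ i = 0" for u v :: "int fps"
    unfolding fps_mult_nth
  proof (intro sum.neutral ballI)
    fix i
    show "u $ i * v $ (m - i) = 0"
      using that(1)[of i] that(2)[of "m - i"] m by (cases "i > n") auto
  qed
  have four: "4 dvd f * g - A * (1 + 2 * (N - S))"
    using data by (simp add: necklace_data_def g_def A_def)
  have "even (((A * (N - S)) $ m))"
  proof -
    have "4 dvd (f * g - A * (1 + 2 * (N - S))) $ m"
      using four numeral_dvd_fps_iff by blast
    also have "(f * g - A * (1 + 2 * (N - S))) $ m = - 2 * (A * (N - S)) $ m"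
    proof -
      have "f * g - A * (1 + 2 * (N - S)) = f * g - A - fps_const 2 * (A * (N - S))"
        by (simp add: algebra_simps flip: numeral_fps_const)
      moreover have "(f * g) $ m = 0" by (rule prod0[OF deg deg_g])
      ultimately show ?thesis
        using deg_A[OF m] by (simp only: fps_sub_nth fps_mult_left_const_nth)
    qed
    finally show ?thesis by presburger
  qed
  moreover have "even ((A * S) $ m)"
  proof -
    obtain k where "f * g - A * (1 + 2 * (N - S)) = 4 * k"
      using four by (elim dvdE)
    then have "A = f * g - 2 * (A * (N - S) + 2 * k)"
      by (simp add: algebra_simps)
    then have "A * S = (f * g - 2 * (A * (N - S) + 2 * k)) * S"
      by (rule arg_cong)
    also have "\<dots> = g * (f * S) - 2 * ((A * (N - S) + 2 * k) * S)"
      by (simp add: algebra_simps)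
    also have "f * S = - (fps_X * fps_deriv f)"
      using data by (simp add: necklace_data_def)
    finally have "A * S = g * - (fps_X * fps_deriv f) - fps_const 2 * ((A * (N - S) + 2 * k) * S)"
      by (simp only: numeral_fps_const)
    then have "(A * S) $ m = (g * - (fps_X * fps_deriv f)) $ m - 2 * ((A * (N - S) + 2 * k) * S) $ m"
      by (simp only: fps_sub_nth fps_mult_left_const_nth)
    moreover have "(g * - (fps_X * fps_deriv f)) $ m = 0"
      by (rule prod0[OF deg_g]) (use deg in auto)
    ultimately show ?thesis by simp
  qed
  ultimately show ?thesis
    by (simp add: right_diff_distrib A_def)
qed

section \<open>Power sums of the roots\<close>

text \<open>
  Newton's identities in generating function form: after division by the product, both sides are
  additive over the factors, and a single factor \<open>1 - x t\<close> contributes the geometric series \<open>x t / (1 - x t)\<close>.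
\<close>
lemma power_sums_log_deriv:
  fixes A :: "'a :: comm_ring_1 multiset"
  shows "(\<Prod>x\<in>#A. 1 - fps_const x * fps_X) * Abs_fps (\<lambda>j. if j = 0 then 0 else \<Sum>x\<in>#A. x ^ j)
       = - (fps_X * fps_deriv (\<Prod>x\<in>#A. 1 - fps_const x * fps_X))"
proof (induction A)
  case empty
  show ?case by (simp add: fps_eq_iff)
next
  case (add x A)
  define q where "q = (\<Prod>x\<in>#A. 1 - fps_const x * fps_X)"
  define P where "P = Abs_fps (\<lambda>j. if j = 0 then 0 else \<Sum>x\<in>#A. x ^ j)"
  define G where "G = Abs_fps (\<lambda>j. if j = 0 then 0 else x ^ j)"
  have G: "(1 - fps_const x * fps_X) * G = fps_const x * fps_X"
  proof (rule fps_ext)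
    fix j
    show "((1 - fps_const x * fps_X) * G) $ j = (fps_const x * fps_X) $ j"
      by (cases j rule: nat.exhaust; cases "j - 1")
         (auto simp: left_diff_distrib mult.assoc G_def)
  qed
  have "Abs_fps (\<lambda>j. if j = 0 then 0 else \<Sum>y\<in>#add_mset x A. y ^ j) = P + G"
    by (simp add: P_def G_def fps_eq_iff add.commute)
  then have "(\<Prod>x\<in>#add_mset x A. 1 - fps_const x * fps_X)
      * Abs_fps (\<lambda>j. if j = 0 then 0 else \<Sum>y\<in>#add_mset x A. y ^ j)
      = (1 - fps_const x * fps_X) * (q * P) + q * ((1 - fps_const x * fps_X) * G)"
    by (simp add: q_def algebra_simps)
  also have "\<dots> = - (fps_X * fps_deriv ((1 - fps_const x * fps_X) * q))"
  proof -
    have IH: "q * P = - (fps_X * fps_deriv q)"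
      using add.IH by (simp only: q_def P_def)
    show ?thesis unfolding G IH by (simp add: algebra_simps)
  qed
  finally show ?case by (simp add: q_def)
qed

text \<open>
  The product of \<open>1 + \<theta> t\<close> over the roots. The value \<open>a 0\<close> is arbitrary and must not enter, hence the
  separate constant term.
\<close>
definition esym_fps :: "nat \<Rightarrow> (nat \<Rightarrow> int) \<Rightarrow> int fps" where
  "esym_fps n a = Abs_fps (\<lambda>i. if i = 0 then 1 else if i \<le> n then a i else 0)"

lemma coeff_sym_poly:
  "coeff (sym_poly n a) k = (if k \<le> n then (-1) ^ (n - k) * of_int (esym_fps n a $ (n - k)) else 0)"
proof -
  have "coeff (sym_poly n a) k
      = (if k = n then 1 else 0) + (\<Sum>i=1..n. if n - i = k then (-1) ^ i * of_int (a i) else 0)"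
    by (simp add: sym_poly_def coeff_sum)
  also have "(\<Sum>i=1..n. if n - i = k then (-1) ^ i * of_int (a i) else 0)
      = (\<Sum>i=1..n. if i = n - k then (if k \<le> n then (-1) ^ i * of_int (a i) else 0) else (0::complex))"
    by (intro sum.cong) auto
  finally show ?thesis
    by (auto simp: esym_fps_def)
qed

text \<open>Reversing the coefficients of the monic polynomial turns each factor \<open>X - \<theta>\<close> into \<open>1 - \<theta> t\<close>.\<close>
lemma prod_roots_sym_poly:
  "(\<Prod>x\<in>#proots (sym_poly n a). 1 - fps_const x * fps_X)
     = Abs_fps (\<lambda>i. (-1) ^ i * of_int (esym_fps n a $ i))"
proof -
  let ?p = "sym_poly n a"
  have top: "coeff ?p n = 1" by (simp add: coeff_sym_poly esym_fps_def)
  then have deg: "degree ?p = n"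
    by (intro antisym degree_le le_degree) (auto simp: coeff_sym_poly)
  have refl: "reflect_poly (\<Prod>x\<in>#A. [:- x, 1:]) = (\<Prod>x\<in>#A. [:1, - x:])" for A :: "complex multiset"
  proof (induction A)
    case (add x A)
    have "reflect_poly [:- x, 1:] = [:1, - x:]"
      by (rule poly_eqI) (simp add: coeff_reflect_poly coeff_pCons split: nat.splits)
    then show ?case
      using add by (simp only: image_mset_add_mset prod_mset.add_mset reflect_poly_mult)
  qed simp
  have fps: "fps_of_poly (\<Prod>x\<in>#A. [:1, - x:]) = (\<Prod>x\<in>#A. 1 - fps_const x * fps_X)" for A :: "complex multiset"
  proof (induction A)
    case (add x A)
    have "fps_of_poly [:1, - x:] = 1 - fps_const x * fps_X"
      by (simp add: fps_of_poly_linear' fps_const_neg [symmetric] del: fps_const_neg)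
    then show ?case
      using add by (simp only: image_mset_add_mset prod_mset.add_mset fps_of_poly_mult)
  qed simp
  have "reflect_poly ?p = (\<Prod>x\<in>#proots ?p. [:1, - x:])"
  proof -
    have "(\<Prod>x\<in>#proots ?p. [:- x, 1:]) = ?p"
      using complex_poly_decompose_multiset[of ?p] top deg by simp
    then show ?thesis using refl[of "proots ?p"] by (simp only:)
  qed
  then have "(\<Prod>x\<in>#proots ?p. 1 - fps_const x * fps_X) = fps_of_poly (reflect_poly ?p)"
    by (simp add: fps)
  also have "\<dots> = Abs_fps (\<lambda>i. (-1) ^ i * of_int (esym_fps n a $ i))"
    by (intro fps_ext) (auto simp: coeff_reflect_poly deg coeff_sym_poly esym_fps_def)
  finally show ?thesis .
qed

text \<open>
  The substitution \<open>t \<mapsto> -t\<close> carries the product of the \<open>1 - \<theta> t\<close> to \<open>f\<close> and produces the signs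
  \<open>(-1)\<^sup>j\<close>; both sides then solve the equation \<open>f S = - t f'\<close>, whose solution is unique.
\<close>
lemma necklace_data_power_sum:
  assumes "necklace_data (esym_fps n a) S N" "j \<ge> 1"
  shows "of_int (S $ j) = (-1) ^ j * root_power_sum n a j"
proof -
  let ?f = "esym_fps n a"
  define fc :: "complex fps" where "fc = Abs_fps (\<lambda>i. of_int (?f $ i))"
  define q where "q = (\<Prod>x\<in>#proots (sym_poly n a). 1 - fps_const x * fps_X)"
  define P where "P = Abs_fps (\<lambda>j. if j = 0 then 0 else root_power_sum n a j)"
  have qP: "q * P = - (fps_X * fps_deriv q)"
    using power_sums_log_deriv[of "proots (sym_poly n a)"]
    unfolding q_def P_def root_power_sum_def .
  have fc: "fc = q oo - fps_X"
    by (simp add: q_def prod_roots_sym_poly fc_def fps_compose_uminus' fps_eq_iff)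
  have "Abs_fps (\<lambda>j. of_int (S $ j)) $ j = (P oo - fps_X) $ j"
  proof (rule fps_solution_unique_upto[of fc j])
    show "fc $ 0 = 1" by (simp add: fc_def esym_fps_def)
    fix i
    have "(fc * Abs_fps (\<lambda>j. of_int (S $ j))) $ i = of_int ((?f * S) $ i)"
      by (simp add: fps_mult_nth fc_def)
    also have "\<dots> = - of_nat i * fc $ i"
      using assms(1) by (cases i) (simp_all add: necklace_data_def fc_def algebra_simps)
    also have "\<dots> = (q * P oo - fps_X) $ i"
      unfolding qP fc by (cases i) (simp_all add: fps_compose_uminus' algebra_simps)
    also have "q * P oo - fps_X = fc * (P oo - fps_X)"
      by (simp add: fc fps_compose_mult_distrib)
    finally show "(fc * Abs_fps (\<lambda>j. of_int (S $ j))) $ i = (fc * (P oo - fps_X)) $ i" .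
  qed simp
  then show ?thesis using assms(2) by (simp add: P_def fps_compose_uminus')
qed

lemma F_eq_necklace_count:
  assumes "necklace_data (esym_fps n a) S N" "m \<ge> 1"
  shows "F n a m = of_int (N $ m)"
proof -
  have tot: "of_nat (totient k) = of_nat k * (\<Prod>p\<in>prime_factors k. 1 - 1 / of_nat p :: complex)" for k
    using arg_cong[OF totient_formula2[of k], of complex_of_real] by simp
  have "of_nat m * F n a m = (\<Sum>j | j dvd m. of_nat (totient (m div j)) * of_int (S $ j))"
    unfolding F_def sum_distrib_left
  proof (intro sum.cong refl)
    fix j assume "j \<in> {j. j dvd m}"
    then obtain k where k: "m = j * k" by auto
    then have "j \<ge> 1" "k \<ge> 1" using assms(2) by auto
    then show "of_nat m * ((-1) ^ j * (root_power_sum n a j / of_nat j) *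
        (\<Prod>p\<in>prime_factors (m div j). 1 - 1 / of_nat p))
        = of_nat (totient (m div j)) * of_int (S $ j)"
      using necklace_data_power_sum[OF assms(1), of j] by (simp add: k tot)
  qed
  also have "\<dots> = of_int (int m * N $ m)"
    using assms by (simp add: necklace_data_def)
  finally show ?thesis using assms(2) by simp
qed

section \<open>Integrality and periodicity\<close>

theorem theorem1p5:
  fixes n :: nat and a :: "nat \<Rightarrow> int"
  assumes "n \<ge> 1"
  shows "(\<forall>m\<ge>1. F n a m \<in> \<int>) \<and>
         eventually_periodic (F_mod2 n a) \<and>
         (odd (a n) \<longrightarrow> periodic (F_mod2 n a))"
proof -
  let ?f = "esym_fps n a"
  obtain S N where data: "necklace_data ?f S N"
    using necklace_data_exists[of ?f] by (auto simp: esym_fps_def)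
  have F: "F n a m = of_int (N $ m)" if "m \<ge> 1" for m
    using F_eq_necklace_count[OF data that] .
  have mod2: "F_mod2 n a m = N $ m mod 2" if "m \<ge> 1" for m
    using F[OF that] by (simp add: F_mod2_def)
  let ?c = "\<lambda>i. (?f oo fps_X\<^sup>2) $ i"
  have deg: "?f $ i = 0" if "i > n" for i using that by (simp add: esym_fps_def)
  have rec: "even (\<Sum>i\<le>2*n. ?c i * N $ (x + 2 * n - i))" if "x \<ge> 1" for x
  proof -
    have "((?f oo fps_X\<^sup>2) * N) $ (x + 2 * n) = (\<Sum>i\<le>2*n. ?c i * N $ (x + 2 * n - i))"
      unfolding fps_mult_nth
      by (rule sum.mono_neutral_right) (auto simp: fps_nth_compose_X_power intro!: deg)
    then show ?thesis
      using necklace_data_even_recurrence[OF data deg, where m = "x + 2 * n"] that by simp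
  qed
  have c: "odd (?c 0)" "?c (2 * n) = a n"
    using assms by (simp_all add: fps_nth_compose_X_power esym_fps_def)
  have D: "2 * n \<ge> 1" using assms by simp
  have "eventually_periodic (\<lambda>m. N $ m mod 2)"
    by (rule periodic_of_even_recurrence(1)[OF D c(1) rec])
  then obtain p M where "p \<ge> 1" "M \<ge> 1" "\<forall>x\<ge>M. N $ (x + p) mod 2 = N $ x mod 2"
    unfolding eventually_periodic_def by auto
  then have ev: "eventually_periodic (F_mod2 n a)"
    unfolding eventually_periodic_def
    by (intro exI[of _ p] conjI exI[of _ M]) (auto simp: mod2)
  have "periodic (F_mod2 n a)" if "odd (a n)"
  proof -
    have "periodic (\<lambda>m. N $ m mod 2)"
      using that c(2) by (intro periodic_of_even_recurrence(2)[OF D c(1) rec]) simp_all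
    then show ?thesis by (simp add: periodic_def mod2)
  qed
  with ev F show ?thesis by simp
qed

end
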